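(* Let $\sigma$ be a permutation of size $n$ ending with its maximum (i.e. $\sigma_n=n$), and let $k$ be the number of left-to-right maxima of $\sigma$ (including $n$). There is a bijective correspondence between the preimages of $\sigma$ under $\mathbf{B}$ and the subsets of the set of the $k-1$ left-to-right maxima of $\sigma$ different from $n$. More precisely, the correspondence works as follows: for any set $S=\{s_1<\dots<s_j\}$ of $j\le k-1$ left-to-right maxima of $\sigma$ different from $n$, writing $\sigma=B_0\,s_1\,B_1\,s_2\,B_2\dots s_{j-1}\,B_{j-1}\,s_j\,B_j\,n$ (with the $B_i$ possibly empty sequences of integers, which contain the $k-1-j$ left-to-right maxima of $\sigma$ different from $n$ not in $S$ and the elements of $\sigma$ which are not left-to-right maxima), the corresponding preimage of $\sigma$ is $s_1\,B_0\,s_2\,B_1\dots s_j\,B_{j-1}\,n\,B_j$.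
   Context: A permutation of size $n$ is a sequence $\pi=\pi_1\pi_2\dots\pi_n$ containing each of $1,\dots,n$ exactly once. An element $\pi_j$ is a left-to-right maximum of $\pi$ if $\pi_j>\pi_i$ for all $i<j$. The bubblesort operator $\mathbf{B}$ is one pass of the bubblesort algorithm: scan the positions from left to right, each time exchanging the current element with the one to its right whenever the latter is smaller. Equivalently, writing $\pi=\mu_1A_1\mu_2A_2\dots\mu_kA_k$ where the $\mu_i$ are all the left-to-right maxima of $\pi$ (and the $A_i$ are possibly empty sequences), $\mathbf{B}(\pi)=A_1\mu_1A_2\mu_2\dots A_k\mu_k$. A preimage of $\sigma$ under $\mathbf{B}$ is a permutation $\pi$ with $\mathbf{B}(\pi)=\sigma$. *)

theory Defs
  imports "HOL-Combinatorics.Multiset_Permutations"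
begin

text \<open>
  A permutation of size \<open>n\<close> is a list in \<open>permutations_of_set {1..n}\<close>, i.e. a list in which
  each of \<open>1, \<dots>, n\<close> occurs exactly once.
\<close>

definition lr_maxima :: "nat list \<Rightarrow> nat set" where
  "lr_maxima \<pi> = {\<pi> ! j | j. j < length \<pi> \<and> (\<forall>i<j. \<pi> ! i < \<pi> ! j)}"

text \<open>One pass of bubblesort; the head of the argument is the element currently being carried.\<close>

fun bubble :: "nat list \<Rightarrow> nat list" where
  "bubble [] = []"
| "bubble [x] = [x]"
| "bubble (x # y # xs) = (if y < x then y # bubble (x # xs) else x # bubble (y # xs))"

text \<open>The size of a preimage is not prescribed; it is forced by \<open>bubble \<pi> = \<sigma>\<close>.\<close>

definition preimages :: "nat list \<Rightarrow> nat list set" where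
  "preimages \<sigma> = {\<pi>. \<pi> \<in> permutations_of_set {1..length \<pi>} \<and> bubble \<pi> = \<sigma>}"

text \<open>
  For \<open>ss = [s\<^sub>1, \<dots>, s\<^sub>j]\<close>, \<open>is_splitting \<sigma> n ss [B\<^sub>0, \<dots>, B\<^sub>j]\<close> says
  \<open>\<sigma> = B\<^sub>0 s\<^sub>1 B\<^sub>1 s\<^sub>2 \<dots> s\<^sub>j B\<^sub>j n\<close>, and \<open>recombine n ss [B\<^sub>0, \<dots>, B\<^sub>j]\<close> is
  \<open>s\<^sub>1 B\<^sub>0 s\<^sub>2 B\<^sub>1 \<dots> s\<^sub>j B\<^bsub>j-1\<^esub> n B\<^sub>j\<close>.  The length condition is needed because
  \<open>map2\<close> truncates to the shorter list.
\<close>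

definition is_splitting :: "nat list \<Rightarrow> nat \<Rightarrow> nat list \<Rightarrow> nat list list \<Rightarrow> bool" where
  "is_splitting \<sigma> n ss Bs \<longleftrightarrow>
     length Bs = length ss + 1 \<and> \<sigma> = concat (map2 (\<lambda>B s. B @ [s]) Bs (ss @ [n]))"

definition recombine :: "nat \<Rightarrow> nat list \<Rightarrow> nat list list \<Rightarrow> nat list" where
  "recombine n ss Bs = concat (map2 (\<lambda>s B. s # B) (ss @ [n]) Bs)"

end

theory Submission
  imports Defs
begin

text \<open>
  Cut a permutation \<open>\<pi>\<close> into blocks \<open>s # B\<close>, each beginning at a left-to-right maximum.  Bubblesort
  carries \<open>s\<close> past the smaller elements of \<open>B\<close> and drops it there, since the next block begins with
  something larger; so it turns each block into \<open>B @ [s]\<close>, where \<open>s\<close> is still a left-to-right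
  maximum.  Conversely, a set of left-to-right maxima of \<open>\<sigma>\<close> containing \<open>last \<sigma>\<close> cuts \<open>\<sigma>\<close> into blocks
  of the form \<open>B @ [s]\<close>, and moving each \<open>s\<close> to the front of its block gives a preimage whose
  left-to-right maxima are exactly the chosen ones, so that the set can be recovered from it.
\<close>

section \<open>Left-to-right maxima of concatenations\<close>

lemma lr_maxima_Cons: "lr_maxima (x # xs) = insert x {y \<in> lr_maxima xs. x < y}"
proof (intro equalityI subsetI)
  fix y assume "y \<in> lr_maxima (x # xs)"
  then obtain j where j: "j < Suc (length xs)" "y = (x # xs) ! j"
    "\<forall>i<j. (x # xs) ! i < (x # xs) ! j"
    unfolding lr_maxima_def by auto
  show "y \<in> insert x {y \<in> lr_maxima xs. x < y}"
  proof (cases j)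
    case (Suc i)
    have "\<forall>l<i. xs ! l < xs ! i" using j(3) Suc by fastforce
    moreover have "x < xs ! i" using j(3) Suc by fastforce
    ultimately show ?thesis using j Suc unfolding lr_maxima_def by auto
  qed (use j in auto)
next
  fix y assume "y \<in> insert x {y \<in> lr_maxima xs. x < y}"
  then consider "y = x" | "y \<in> lr_maxima xs" "x < y" by auto
  then show "y \<in> lr_maxima (x # xs)"
  proof cases
    case 1
    then show ?thesis unfolding lr_maxima_def by (auto intro!: exI[of _ 0])
  next
    case 2
    then obtain j where "j < length xs" "y = xs ! j" "\<forall>i<j. xs ! i < xs ! j"
      unfolding lr_maxima_def by auto
    then have "Suc j < length (x # xs) \<and> y = (x # xs) ! Suc j
        \<and> (\<forall>i<Suc j. (x # xs) ! i < (x # xs) ! Suc j)"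
      using 2 by (auto simp: less_Suc_eq_0_disj)
    then show ?thesis unfolding lr_maxima_def by blast
  qed
qed

lemma lr_maxima_Nil [simp]: "lr_maxima [] = {}"
  by (simp add: lr_maxima_def)

lemma lr_maxima_append:
  "lr_maxima (xs @ ys) = lr_maxima xs \<union> {y \<in> lr_maxima ys. \<forall>x\<in>set xs. x < y}"
  by (induction xs) (auto simp: lr_maxima_Cons)

lemma lr_maxima_subset: "lr_maxima xs \<subseteq> set xs"
  by (auto simp: lr_maxima_def)

text \<open>By distinctness \<open>s\<close> does not occur in \<open>xs\<close>, so it enters
  through the second set of \<open>lr_maxima_append\<close>, whose members exceed all of
  \<open>xs\<close>.\<close>

lemma lr_maxima_prefix_less:
  assumes "distinct (xs @ s # ys)" "s \<in> lr_maxima (xs @ s # ys)" "x \<in> set xs"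
  shows "x < s"
  using assms lr_maxima_subset[of xs] by (auto simp: lr_maxima_append)

text \<open>Everything in \<open>xs\<close> is below \<open>s\<close>, so a larger \<open>t\<close>
  must come from \<open>ys\<close>. This drives inductions over blocks: after a cut at
  \<open>s\<close>, the later chosen elements are still maxima of the remainder.\<close>

lemma lr_maxima_suffix:
  assumes "distinct (xs @ s # ys)" "s \<in> lr_maxima (xs @ s # ys)"
    and "t \<in> lr_maxima (xs @ s # ys)" "s < t"
  shows "t \<in> lr_maxima ys"
  using assms lr_maxima_prefix_less[OF assms(1,2), of t] lr_maxima_subset[of xs]
  by (auto simp: lr_maxima_append lr_maxima_Cons)

section \<open>Lists cut into blocks\<close>

definition lasts_last :: "nat list \<Rightarrow> nat list list \<Rightarrow> nat list" where
  "lasts_last ts Bs = concat (map2 (\<lambda>B s. B @ [s]) Bs ts)"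

definition lasts_first :: "nat list \<Rightarrow> nat list list \<Rightarrow> nat list" where
  "lasts_first ts Bs = concat (map2 (\<lambda>s B. s # B) ts Bs)"

abbreviation dominated :: "nat list \<Rightarrow> nat list list \<Rightarrow> bool" where
  "dominated \<equiv> list_all2 (\<lambda>s B. \<forall>b\<in>set B. b < s)"

lemma lasts_last_simps [simp]:
  "lasts_last [] Bs = []" "lasts_last ts [] = []"
  "lasts_last (s # ts) (B # Bs) = B @ s # lasts_last ts Bs"
  by (simp_all add: lasts_last_def)

lemma lasts_first_simps [simp]:
  "lasts_first [] Bs = []" "lasts_first ts [] = []"
  "lasts_first (s # ts) (B # Bs) = s # B @ lasts_first ts Bs"
  by (simp_all add: lasts_first_def)

text \<open>With \<open>n\<close> appended to the separators, the final piece has the shape of the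
  others, and inductions need no special case for it.\<close>

lemma is_splitting_iff:
  "is_splitting \<sigma> n ss Bs \<longleftrightarrow>
     length (ss @ [n]) = length Bs \<and> \<sigma> = lasts_last (ss @ [n]) Bs"
  by (auto simp: is_splitting_def lasts_last_def)

lemma recombine_eq: "recombine n ss Bs = lasts_first (ss @ [n]) Bs"
  by (simp add: recombine_def lasts_first_def)

lemma mset_lasts_first:
  "length ts = length Bs \<Longrightarrow> mset (lasts_first ts Bs) = mset (lasts_last ts Bs)"
  by (induction ts Bs rule: list_induct2) auto

lemma set_lasts_last:
  "length ts = length Bs \<Longrightarrow> set (lasts_last ts Bs) = set ts \<union> (\<Union>B\<in>set Bs. set B)"
  by (induction ts Bs rule: list_induct2) auto

lemma distinct_lasts_last_disjoint:
  "length ts = length Bs \<Longrightarrow> distinct (lasts_last ts Bs) \<Longrightarrow> set ts \<inter> (\<Union>B\<in>set Bs. set B) = {}"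
proof (induction ts Bs rule: list_induct2)
  case (Cons t ts B Bs)
  then show ?case using set_lasts_last[OF Cons.hyps] by auto
qed simp

text \<open>Since \<open>t\<close> occurs only once, its position fixes the first block; the others
  follow by induction.\<close>

lemma lasts_last_inject:
  assumes "length ts = length Bs" "length ts = length Bs'"
    and "distinct (lasts_last ts Bs)" "lasts_last ts Bs = lasts_last ts Bs'"
  shows "Bs = Bs'"
  using assms
proof (induction ts Bs arbitrary: Bs' rule: list_induct2)
  case (Cons t ts B Bs)
  then obtain B' Cs where Bs': "Bs' = B' # Cs" by (cases Bs') auto
  have eq: "B @ t # lasts_last ts Bs = B' @ t # lasts_last ts Cs"
    using Cons.prems Bs' by simp
  have "distinct (B @ t # lasts_last ts Bs)" "distinct (B' @ t # lasts_last ts Cs)"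
    using Cons.prems(2) eq by (auto simp del: distinct_append)
  then have "B = B' \<and> lasts_last ts Bs = lasts_last ts Cs"
    using eq by (subst (asm) append_Cons_eq_iff) auto
  then show ?case using Cons Bs' by auto
qed simp

lemma last_lasts_last:
  "length ts = length Bs \<Longrightarrow> ts \<noteq> [] \<Longrightarrow> last (lasts_last ts Bs) = last ts"
proof (induction ts Bs rule: list_induct2)
  case (Cons t ts B Bs)
  then show ?case by (cases ts; cases Bs) auto
qed simp

section \<open>Bubblesort and maxima on dominated blocks\<close>

lemma bubble_append_smaller:
  "\<forall>b\<in>set B. b < x \<Longrightarrow> bubble (x # B @ ys) = B @ bubble (x # ys)"
  by (induction B) auto

text \<open>The carried \<open>t\<close> passes its whole block, then meets the next separator,
  which is larger, and is dropped just before it.\<close>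

lemma bubble_lasts_first:
  "dominated ts Bs \<Longrightarrow> sorted_wrt (<) ts \<Longrightarrow> bubble (lasts_first ts Bs) = lasts_last ts Bs"
proof (induction rule: list_all2_induct)
  case (Cons t ts B Bs)
  then show ?case
    \<comment> \<open>The instance with \<open>[]\<close> handles the last block, after which no
      separator follows.\<close>
    using bubble_append_smaller[of B t "[]"]
    by (cases ts; cases Bs) (auto simp: bubble_append_smaller)
qed simp

text \<open>Each separator stands before its block and hides it, while later separators exceed
  everything earlier. Hence a preimage determines its separators, which gives injectivity.\<close>

lemma lr_maxima_lasts_first:
  "dominated ts Bs \<Longrightarrow> sorted_wrt (<) ts \<Longrightarrow> lr_maxima (lasts_first ts Bs) = set ts"
proof (induction rule: list_all2_induct)
  case (Cons t ts B Bs)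
  then show ?case using lr_maxima_subset[of B]
    by (fastforce simp: lr_maxima_Cons lr_maxima_append)
qed simp

text \<open>Only an inclusion: a block now precedes its separator, so it may contain maxima that
  were not chosen.\<close>

lemma subset_lr_maxima_lasts_last:
  "dominated ts Bs \<Longrightarrow> sorted_wrt (<) ts \<Longrightarrow> set ts \<subseteq> lr_maxima (lasts_last ts Bs)"
proof (induction rule: list_all2_induct)
  case (Cons t ts B Bs)
  then show ?case
    by (fastforce simp: lr_maxima_Cons lr_maxima_append)
qed simp

text \<open>A left-to-right maximum exceeds all that precedes it, in particular the block it
  closes.\<close>

lemma dominated_if_lr_maxima:
  assumes "length ts = length Bs" "distinct (lasts_last ts Bs)"
    and "sorted_wrt (<) ts" "set ts \<subseteq> lr_maxima (lasts_last ts Bs)"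
  shows "dominated ts Bs"
  using assms
proof (induction ts Bs rule: list_induct2)
  case (Cons t ts B Bs)
  have "\<forall>b\<in>set B. b < t"
    using lr_maxima_prefix_less Cons.prems by fastforce
  moreover have "set ts \<subseteq> lr_maxima (lasts_last ts Bs)"
    using lr_maxima_suffix[of B t] Cons.prems by fastforce
  ultimately show ?case using Cons by auto
qed simp

section \<open>Existence of block decompositions\<close>

text \<open>Cut at the first separator and recurse on what follows it. The condition on
  \<open>last\<close> ensures that nothing is left over after the final cut.\<close>

lemma ex_lasts_last:
  assumes "ts \<noteq> []" "distinct xs" "sorted_wrt (<) ts" "set ts \<subseteq> lr_maxima xs" "last ts = last xs"
  shows "\<exists>Bs. length ts = length Bs \<and> xs = lasts_last ts Bs"
  using assms
proof (induction ts arbitrary: xs rule: list_nonempty_induct)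
  case (single t)
  then have "xs \<noteq> []" by auto
  then have "xs = lasts_last [t] [butlast xs]" using single by simp
  then show ?case by (metis length_Cons list.size(3))
next
  case (cons t ts)
  then have "t \<in> set xs" using lr_maxima_subset by fastforce
  then obtain B ys where xs: "xs = B @ t # ys" by (meson split_list)
  have sub: "set ts \<subseteq> lr_maxima ys"
    using lr_maxima_suffix[of B t ys] cons.prems xs by fastforce
  then have "ys \<noteq> []" using cons.hyps by auto
  then have "last ts = last ys" using cons xs by simp
  then obtain Bs where "length ts = length Bs" "ys = lasts_last ts Bs"
    using cons.IH[of ys] cons.prems xs sub by auto
  then show ?case using xs by (intro exI[of _ "B # Bs"]) simp
qed

text \<open>The head opens a block that extends as long as the elements are smaller; the remainder
  is shorter, so length induction applies.\<close>

lemma ex_lasts_first: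
  assumes "distinct xs"
  shows "\<exists>ts Bs. dominated ts Bs \<and> sorted_wrt (<) ts \<and> xs = lasts_first ts Bs"
  using assms
proof (induction xs rule: length_induct)
  case (1 xs)
  show ?case
  proof (cases xs)
    case Nil
    then show ?thesis by (intro exI[of _ "[]"]) simp
  next
    case (Cons x ys)
    let ?B = "takeWhile (\<lambda>y. y < x) ys" and ?zs = "dropWhile (\<lambda>y. y < x) ys"
    have "length ?zs < length xs" "distinct ?zs"
      using Cons 1 by (auto simp: le_imp_less_Suc length_dropWhile_le distinct_dropWhile)
    then obtain ts Bs where
      *: "dominated ts Bs" "sorted_wrt (<) ts" "?zs = lasts_first ts Bs"
      using 1 by blast
    \<comment> \<open>The next separator is the element that stopped \<open>dropWhile\<close>, so it
      is not below \<open>x\<close>, and distinctness excludes equality.\<close>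
    have "\<forall>t\<in>set ts. x < t"
    proof (cases ts)
      case (Cons t us)
      then obtain C Cs where zs: "?zs = t # C @ lasts_first us Cs"
        using * by (cases Bs) auto
      then have "\<not> t < x" "t \<in> set ys"
        by (metis hd_dropWhile list.sel(1) list.discI)
          (metis zs list.set_intros(1) set_dropWhileD)
      then have "x < t" using \<open>xs = x # ys\<close> "1.prems" by (cases "x = t") auto
      then show ?thesis using Cons *(2) by auto
    qed simp
    moreover have "xs = lasts_first (x # ts) (?B # Bs)"
      using Cons * by (metis append_Cons lasts_first_simps(3) takeWhile_dropWhile_id)
    moreover have "dominated (x # ts) (?B # Bs)"
      using * by (auto dest: set_takeWhileD)
    ultimately show ?thesis using *(2)
      by (intro exI[of _ "x # ts"] exI[of _ "?B # Bs"]) auto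
  qed
qed

theorem corollary2p3:
  fixes n k :: nat and \<sigma> :: "nat list"
  assumes "n \<ge> 1"
    and "\<sigma> \<in> permutations_of_set {1..n}"
    and "last \<sigma> = n"
    and "k = card (lr_maxima \<sigma>)"
  shows "n \<in> lr_maxima \<sigma> \<and> card (lr_maxima \<sigma> - {n}) = k - 1 \<and>
    (\<exists>f. bij_betw f (Pow (lr_maxima \<sigma> - {n})) (preimages \<sigma>) \<and>
      (\<forall>S \<subseteq> lr_maxima \<sigma> - {n}.
         card S \<le> k - 1 \<and>
         card (lr_maxima \<sigma> - {n} - S) = k - 1 - card S \<and>
         (\<exists>!Bs. is_splitting \<sigma> n (sorted_list_of_set S) Bs) \<and>
         (\<forall>Bs. is_splitting \<sigma> n (sorted_list_of_set S) Bs \<longrightarrow>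
            (\<Union>B\<in>set Bs. set B) = (lr_maxima \<sigma> - {n} - S) \<union> (set \<sigma> - lr_maxima \<sigma>) \<and>
            f S = recombine n (sorted_list_of_set S) Bs)))"
proof -
  let ?M = "lr_maxima \<sigma> - {n}"
  \<comment> \<open>The blocks have to be a function of \<open>S\<close> alone, hence
    \<open>THE\<close>; \<open>ex1\<close> justifies it and \<open>f_eq\<close> then allows any
    splitting to be used.\<close>
  define f where
    "f S = recombine n (sorted_list_of_set S) (THE Bs. is_splitting \<sigma> n (sorted_list_of_set S) Bs)"
    for S
  have set\<sigma>: "set \<sigma> = {1..n}" and dist: "distinct \<sigma>"
    using assms(2) by (auto simp: permutations_of_set_def)
  have ne: "\<sigma> \<noteq> []" using set\<sigma> assms(1) by auto
  have fin: "finite (lr_maxima \<sigma>)"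
    using lr_maxima_subset finite_subset by blast
  have less_n: "x < n" if "x \<in> set \<sigma>" "x \<noteq> n" for x
    using set\<sigma> that by auto
  obtain \<tau> where \<tau>: "\<sigma> = \<tau> @ [n]"
    using ne assms(3) by (metis append_butlast_last_id)
  have n_max: "n \<in> lr_maxima \<sigma>"
    using less_n dist \<tau> by (auto simp: lr_maxima_append lr_maxima_Cons)
  have card_M: "card ?M = k - 1"
    using n_max fin assms(4) by simp
  have sorted: "sorted_wrt (<) (sorted_list_of_set S @ [n])"
    and set_list: "set (sorted_list_of_set S @ [n]) = insert n S" if "S \<subseteq> ?M" for S
  proof -
    have "finite S" using that fin by (meson finite_Diff finite_subset)
    then show "sorted_wrt (<) (sorted_list_of_set S @ [n])"
      "set (sorted_list_of_set S @ [n]) = insert n S"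
      using that less_n lr_maxima_subset by (fastforce simp: sorted_wrt_append)+
  qed
  have ex1: "\<exists>!Bs. is_splitting \<sigma> n (sorted_list_of_set S) Bs" if S: "S \<subseteq> ?M" for S
  proof -
    have "\<exists>Bs. is_splitting \<sigma> n (sorted_list_of_set S) Bs"
      unfolding is_splitting_iff
      using ex_lasts_last[OF _ dist sorted[OF S]] set_list[OF S] S n_max assms(3)
      by (metis Diff_subset insert_subset last_snoc order_trans snoc_eq_iff_butlast)
    moreover have "Bs = Bs'" if "is_splitting \<sigma> n (sorted_list_of_set S) Bs"
      "is_splitting \<sigma> n (sorted_list_of_set S) Bs'" for Bs Bs'
      using that dist unfolding is_splitting_iff by (metis lasts_last_inject)
    ultimately show ?thesis by blast
  qed
  have f_eq: "f S = recombine n (sorted_list_of_set S) Bs"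
    if "S \<subseteq> ?M" "is_splitting \<sigma> n (sorted_list_of_set S) Bs" for S Bs
    using the1_equality[OF ex1[OF that(1)] that(2)] by (simp add: f_def)
  have split: "\<exists>Bs. length (sorted_list_of_set S @ [n]) = length Bs
      \<and> \<sigma> = lasts_last (sorted_list_of_set S @ [n]) Bs
      \<and> f S = lasts_first (sorted_list_of_set S @ [n]) Bs
      \<and> dominated (sorted_list_of_set S @ [n]) Bs" if S: "S \<subseteq> ?M" for S
  proof -
    obtain Bs where Bs: "is_splitting \<sigma> n (sorted_list_of_set S) Bs" using ex1[OF S] by blast
    then have len: "length (sorted_list_of_set S @ [n]) = length Bs"
      and \<sigma>: "\<sigma> = lasts_last (sorted_list_of_set S @ [n]) Bs"
      unfolding is_splitting_iff by blast+
    have "set (sorted_list_of_set S @ [n]) \<subseteq> lr_maxima \<sigma>"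
      unfolding set_list[OF S] using S n_max by blast
    then have "dominated (sorted_list_of_set S @ [n]) Bs"
      using dominated_if_lr_maxima[OF len _ sorted[OF S]] dist \<sigma> by argo
    then show ?thesis using len \<sigma> f_eq[OF S Bs] unfolding recombine_eq by blast
  qed
  have lr_f: "lr_maxima (f S) = insert n S" if S: "S \<subseteq> ?M" for S
  proof -
    obtain Bs where "f S = lasts_first (sorted_list_of_set S @ [n]) Bs"
      "dominated (sorted_list_of_set S @ [n]) Bs"
      using split[OF S] by blast
    then show ?thesis
      using lr_maxima_lasts_first[OF _ sorted[OF S]] set_list[OF S] by simp
  qed
  have f_in: "f S \<in> preimages \<sigma>" if S: "S \<subseteq> ?M" for S
  proof -
    obtain Bs where "length (sorted_list_of_set S @ [n]) = length Bs"
      "\<sigma> = lasts_last (sorted_list_of_set S @ [n]) Bs"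
      "f S = lasts_first (sorted_list_of_set S @ [n]) Bs"
      "dominated (sorted_list_of_set S @ [n]) Bs"
      using split[OF S] by blast
    then have m: "mset (f S) = mset \<sigma>" and "bubble (f S) = \<sigma>"
      using mset_lasts_first bubble_lasts_first[OF _ sorted[OF S]] by simp_all
    \<comment> \<open>\<open>preimages\<close> measures a permutation by its own length, so this
      length must be identified with \<open>n\<close>.\<close>
    moreover have "length (f S) = n"
      using mset_eq_length[OF m] length_finite_permutations_of_set[OF assms(2)] by simp
    ultimately show ?thesis
      using set\<sigma> dist mset_eq_setD[OF m] mset_eq_imp_distinct_iff[OF m]
      by (simp add: preimages_def permutations_of_set_def)
  qed
  have "inj_on f (Pow ?M)"
  proof (rule inj_onI)
    fix S T assume "S \<in> Pow ?M" "T \<in> Pow ?M" "f S = f T"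
    then show "S = T" using lr_f[of S] lr_f[of T] by auto
  qed
  \<comment> \<open>Surjectivity: cut \<open>\<pi>\<close> into blocks. Bubblesort turns them into a
    splitting of \<open>\<sigma>\<close>, whose last separator is \<open>n\<close>; the others form
    the set that \<open>f\<close> maps to \<open>\<pi>\<close>.\<close>
  moreover have "\<pi> \<in> f ` Pow ?M" if "\<pi> \<in> preimages \<sigma>" for \<pi>
  proof -
    have "distinct \<pi>" and bub: "bubble \<pi> = \<sigma>"
      using that by (auto simp: preimages_def permutations_of_set_def)
    then obtain ts Bs where ts: "dominated ts Bs" "sorted_wrt (<) ts" "\<pi> = lasts_first ts Bs"
      using ex_lasts_first by blast
    have len: "length ts = length Bs" using ts(1) by (rule list_all2_lengthD)
    have \<sigma>: "\<sigma> = lasts_last ts Bs" using bub ts bubble_lasts_first by blast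
    have "ts \<noteq> []" using ne \<sigma> by auto
    moreover from this have "last ts = n"
      using last_lasts_last[OF len] \<sigma> assms(3) by simp
    ultimately obtain ss where ss: "ts = ss @ [n]" by (metis append_butlast_last_id)
    have "set ss \<subseteq> ?M"
      using subset_lr_maxima_lasts_last[OF ts(1,2)] ts(2) \<sigma> ss by (auto simp: sorted_wrt_append)
    moreover have "sorted_list_of_set (set ss) = ss"
      using ts(2) ss by (simp add: sorted_wrt_append strict_sorted_equal)
    moreover have "is_splitting \<sigma> n ss Bs"
      using len \<sigma> ss by (simp add: is_splitting_iff)
    ultimately have "f (set ss) = \<pi>"
      using f_eq[of "set ss" Bs] ts(3) ss by (simp add: recombine_eq)
    then show ?thesis using \<open>set ss \<subseteq> ?M\<close> by blast
  qed
  ultimately have "bij_betw f (Pow ?M) (preimages \<sigma>)"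
    using f_in by (auto simp: bij_betw_def)
  moreover have "card S \<le> k - 1 \<and> card (?M - S) = k - 1 - card S" if "S \<subseteq> ?M" for S
    using that card_M fin by (metis card_Diff_subset card_mono finite_Diff finite_subset)
  moreover have "(\<Union>B\<in>set Bs. set B) = (?M - S) \<union> (set \<sigma> - lr_maxima \<sigma>)"
    if S: "S \<subseteq> ?M" and Bs: "is_splitting \<sigma> n (sorted_list_of_set S) Bs" for S Bs
  proof -
    have len: "length (sorted_list_of_set S @ [n]) = length Bs"
      and \<sigma>: "\<sigma> = lasts_last (sorted_list_of_set S @ [n]) Bs"
      using Bs unfolding is_splitting_iff by blast+
    \<comment> \<open>Separators and blocks partition the entries of \<open>\<sigma>\<close>, so the
      blocks hold exactly the entries outside \<open>insert n S\<close>.\<close>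
    have "set \<sigma> = insert n S \<union> (\<Union>B\<in>set Bs. set B)"
      using set_lasts_last[OF len] unfolding set_list[OF S] \<sigma>[symmetric] .
    moreover have "insert n S \<inter> (\<Union>B\<in>set Bs. set B) = {}"
      using distinct_lasts_last_disjoint[OF len] dist
      unfolding set_list[OF S] \<sigma>[symmetric] by blast
    ultimately have "(\<Union>B\<in>set Bs. set B) = set \<sigma> - insert n S" by blast
    also have "\<dots> = (?M - S) \<union> (set \<sigma> - lr_maxima \<sigma>)"
      using S n_max lr_maxima_subset[of \<sigma>] by blast
    finally show ?thesis .
  qed
  ultimately show ?thesis
    using n_max card_M ex1 f_eq by (intro conjI exI[of _ f] allI impI) simp_all
qed

end
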